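(* Let $\beta>0$. The stochastic differential equation on $\mathcal{P}(I)$ $$dp_i(t)=\sum_{j\in N(i)}\omega_{ij}\theta_{ij}(p(t))\Big(\frac{\partial}{\partial p_j}-\frac{\partial}{\partial p_i}\Big)\mathrm{D}_\phi(p(t)\|\pi)\,dt+\beta\sum_{j\in N(i)}\omega_{ij}\theta_{ij}(p(t))\Big(\frac{\partial}{\partial p_j}-\frac{\partial}{\partial p_i}\Big)\log\frac{\Pi(p(t))^{1/2}}{\theta_{ij}(p(t))}\,dt$$ $$+\sqrt\beta\sum_{j\in N(i)}\sqrt{\omega_{ij}\theta_{ij}(p(t))}\,\big(dB_{ij}(t)-dB_{ji}(t)\big),\qquad i\in I,$$ where $B_{ij}$, $1\le i,j\le n$, are independent standard Brownian motions, satisfies $$\dot p_i(t)=\sum_{j=1}^n\Big[Q^W_{ji}(p(t),\beta,\dot B)\,p_j(t)-Q^W_{ij}(p(t),\beta,\dot B)\,p_i(t)\Big],\qquad i\in I,$$ where $\dot B=(\dot B_{ij})$ denotes the formal time derivative of $(B_{ij})$ and the SDE is written formally by dividing by $dt$. In addition, $Q^W$ satisfies the row sum zero condition $$\sum_{j=1}^nQ^W_{ij}(p,\beta,\dot B)=0,\qquad Q^W_{ij}(p,\beta,\dot B)\ge0\ \text{ for } j\ne i.$$ If $\beta=0$, then the Wasserstein $Q$-matrix recovers the $Q$-matrix, i.e. $Q^W(p,0,\dot B)=Q$.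
   Context: **Graph.** $G=(I,E,\omega)$ is a finite connected undirected weighted graph without self-loops, $I=\{1,\dots,n\}$; $\omega=(\omega_{ij})\in\mathbb{R}^{n\times n}$ is symmetric with $\omega_{ij}=\omega_{ji}>0$ if $(i,j)\in E$ and $\omega_{ij}=0$ otherwise. $E$ consists of ordered pairs: each edge contributes both $(i,j)$ and $(j,i)$. $N(i)=\{j:(i,j)\in E\}$. Set $\pi_i=\frac{\sum_{j\in N(i)}\omega_{ij}}{\sum_{(k,l)\in E}\omega_{kl}}$. **Simplex.** $\mathcal{P}(I)=\{p\in\mathbb{R}^n:\sum_i p_i=1,\ p_i>0\}$. **Average function.** $\theta(x,y)=\frac{x-y}{\phi'(x)-\phi'(y)}$ (extended continuously to $x=y$ and to the boundary of $[0,\infty)^2$), where $\phi$ is a $C^1$ convex real function on $(0,\infty)$ with $\phi(1)=0$, such that $\theta:[0,\infty)^2\to[0,\infty)$ satisfies $\theta(x,y)=\theta(y,x)$; $\theta(x,y)>0$ if $xy\neq0$; $\theta(x,y)=0$ if $xy=0$; and $\theta$ is $C^2$ on $(0,\infty)^2$. Write $\theta_{ij}(p)=\theta(p_i/\pi_i,p_j/\pi_j)$. The $\phi$-divergence is $\mathrm{D}_\phi(p\|\pi)=\sum_{i=1}^n\phi\big(\frac{p_i}{\pi_i}\big)\pi_i$. **Weighted Laplacian matrix.** $L(p)_{ij}=-\omega_{ij}\theta_{ij}(p)$ for $j\neq i$ and $L(p)_{ii}=\sum_{k\in N(i)}\omega_{ki}\theta_{ki}(p)$. For $p\in\mathcal{P}(I)$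 it is symmetric positive semidefinite with exactly one zero eigenvalue; $\lambda_1(p),\dots,\lambda_{n-1}(p)>0$ are its positive eigenvalues, and $\Pi(p)=\prod_{i=1}^{n-1}\lambda_i(p)$. Derivatives of functions on the simplex are computed via a smooth extension to a neighbourhood in $\mathbb{R}^n$; only tangential derivatives $\frac{\partial}{\partial p_j}-\frac{\partial}{\partial p_i}$ enter. **$Q$-matrix.** $Q_{ij}=\frac{\omega_{ij}}{\pi_i}$ for $j\ne i$ and $Q_{ii}=-\sum_{k\in N(i)}\frac{\omega_{ik}}{\pi_i}$. **Wasserstein $Q$-matrix.** For $p\in\mathcal{P}(I)$, $\beta\ge0$ and a matrix $\dot B=(\dot B_{ij})\in\mathbb{R}^{n\times n}$ set $$A_{ij}(p)=\beta\,\omega_{ij}\theta_{ij}(p)\Big(\frac{\partial}{\partial p_j}-\frac{\partial}{\partial p_i}\Big)\log\frac{\Pi(p)^{1/2}}{\theta_{ij}(p)}+\sqrt{\beta\,\omega_{ij}\theta_{ij}(p)}\,(\dot B_{ij}-\dot B_{ji}),$$ $$a_{ij}(p)=\frac1{p_i}\max\{0,A_{ji}(p)\},$$ and $Q^W_{ij}(p,\beta,\dot B)=Q_{ij}+a_{ij}(p)$ for $j\neq i$, $Q^W_{ii}(p,\beta,\dot B)=-\sum_{k\in N(i)}(Q_{ik}+a_{ik}(p))$. **Formal reading of the SDE.** The SDE divided by $dt$ is the equation $\dot p_i=\sum_{j\in N(i)}\omega_{ij}\theta_{ij}(p)\big(\frac{\partial}{\partial p_j}-\frac{\partial}{\partial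 p_i}\big)\mathrm{D}_\phi(p\|\pi)+\sum_{j\in N(i)}A_{ij}(p)$; the first assertion is that its right-hand side equals the right-hand side of the equation written with $Q^W$, pointwise in $p\in\mathcal{P}(I)$ and $\dot B\in\mathbb{R}^{n\times n}$. *)

theory Defs
  imports "HOL-Analysis.Analysis"
begin

(* The vertex set I = {1,...,n} is the finite index type 'n, so n = CARD('n).  An undirected edge
   contributes both ordered pairs to E.  The matrix entry M_ij is M $ i $ j. *)

locale weighted_graph =
  fixes E :: "('n::finite \<times> 'n) set" and w :: "real ^ 'n ^ 'n"
  assumes sym_edges: "sym E"
    and no_self_loops: "irrefl E"
    and connected_edges: "\<And>i j. (i, j) \<in> E\<^sup>*"
    and weight_sym: "\<And>i j. w $ i $ j = w $ j $ i"
    and weight_pos: "\<And>i j. (i, j) \<in> E \<Longrightarrow> w $ i $ j > 0"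
    and weight_zero: "\<And>i j. (i, j) \<notin> E \<Longrightarrow> w $ i $ j = 0"

definition neighbours :: "('n \<times> 'n) set \<Rightarrow> 'n \<Rightarrow> 'n set" where
  "neighbours E i = {j. (i, j) \<in> E}"

definition vertex_measure :: "('n::finite \<times> 'n) set \<Rightarrow> real ^ 'n ^ 'n \<Rightarrow> real ^ 'n" where
  "vertex_measure E w = (\<chi> i. (\<Sum>j\<in>neighbours E i. w $ i $ j) / (\<Sum>(k, l)\<in>E. w $ k $ l))"

definition open_simplex :: "(real ^ 'n::finite) set" where
  "open_simplex = {p. (\<Sum>i\<in>UNIV. p $ i) = 1 \<and> (\<forall>i. p $ i > 0)}"

(* Meant for open S: twice continuously Frechet differentiable. *)
definition C2_on :: "('a::real_normed_vector \<Rightarrow> 'b::real_normed_vector) \<Rightarrow> 'a set \<Rightarrow> bool" where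
  "C2_on f S \<longleftrightarrow> (\<exists>(f' :: 'a \<Rightarrow> 'a \<Rightarrow>\<^sub>L 'b) (f'' :: 'a \<Rightarrow> 'a \<Rightarrow>\<^sub>L ('a \<Rightarrow>\<^sub>L 'b)).
     (\<forall>x\<in>S. (f has_derivative blinfun_apply (f' x)) (at x)) \<and>
     (\<forall>x\<in>S. (f' has_derivative blinfun_apply (f'' x)) (at x)) \<and>
     continuous_on S f'')"

(* Only the values of phi on (0,oo) and of theta on [0,oo)^2 matter.  The quotient formula is
   required off the diagonal; the values on the diagonal and on the boundary are determined by
   theta_continuous.  Positivity of theta makes deriv phi x and deriv phi y different for x ~= y,
   so the quotient never involves a division by zero. *)
locale average_function =
  fixes \<phi> :: "real \<Rightarrow> real" and \<theta> :: "real \<Rightarrow> real \<Rightarrow> real"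
  assumes phi_differentiable: "\<And>x. x > 0 \<Longrightarrow> \<phi> differentiable (at x)"
    and phi_C1: "continuous_on {0<..} (deriv \<phi>)"
    and phi_convex: "convex_on {0<..} \<phi>"
    and phi_one: "\<phi> 1 = 0"
    and theta_quotient: "\<And>x y. \<lbrakk>x > 0; y > 0; x \<noteq> y\<rbrakk> \<Longrightarrow>
           \<theta> x y = (x - y) / (deriv \<phi> x - deriv \<phi> y)"
    and theta_continuous: "continuous_on ({0..} \<times> {0..}) (\<lambda>(x, y). \<theta> x y)"
    and theta_sym: "\<And>x y. \<lbrakk>x \<ge> 0; y \<ge> 0\<rbrakk> \<Longrightarrow> \<theta> x y = \<theta> y x"
    and theta_pos: "\<And>x y. \<lbrakk>x \<ge> 0; y \<ge> 0; x * y \<noteq> 0\<rbrakk> \<Longrightarrow> \<theta> x y > 0"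
    and theta_zero: "\<And>x y. \<lbrakk>x \<ge> 0; y \<ge> 0; x * y = 0\<rbrakk> \<Longrightarrow> \<theta> x y = 0"
    and theta_C2: "C2_on (\<lambda>(x, y). \<theta> x y) ({0<..} \<times> {0<..})"

definition edge_theta ::
  "('n::finite \<times> 'n) set \<Rightarrow> real ^ 'n ^ 'n \<Rightarrow> (real \<Rightarrow> real \<Rightarrow> real) \<Rightarrow> real ^ 'n \<Rightarrow> 'n \<Rightarrow> 'n \<Rightarrow> real" where
  "edge_theta E w \<theta> p i j =
     \<theta> (p $ i / vertex_measure E w $ i) (p $ j / vertex_measure E w $ j)"

definition phi_divergence ::
  "('n::finite \<times> 'n) set \<Rightarrow> real ^ 'n ^ 'n \<Rightarrow> (real \<Rightarrow> real) \<Rightarrow> real ^ 'n \<Rightarrow> real" where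
  "phi_divergence E w \<phi> p =
     (\<Sum>i\<in>UNIV. \<phi> (p $ i / vertex_measure E w $ i) * vertex_measure E w $ i)"

definition weighted_laplacian ::
  "('n::finite \<times> 'n) set \<Rightarrow> real ^ 'n ^ 'n \<Rightarrow> (real \<Rightarrow> real \<Rightarrow> real) \<Rightarrow> real ^ 'n \<Rightarrow> real ^ 'n ^ 'n" where
  "weighted_laplacian E w \<theta> p = (\<chi> i j.
     if j = i then (\<Sum>k\<in>neighbours E i. w $ k $ i * edge_theta E w \<theta> p k i)
     else - w $ i $ j * edge_theta E w \<theta> p i j)"

(* Product of the positive eigenvalues, each repeated according to its multiplicity.  It is
   applied to symmetric matrices only, where the multiplicity is the dimension of the eigenspace. *)
definition pos_eigenvalue_prod :: "real ^ 'n ^ 'n::finite \<Rightarrow> real" where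
  "pos_eigenvalue_prod M =
     (\<Prod>l\<in>{l. l > 0 \<and> (\<exists>v. v \<noteq> 0 \<and> M *v v = l *\<^sub>R v)}. l ^ dim {v. M *v v = l *\<^sub>R v})"

definition laplacian_prod ::
  "('n::finite \<times> 'n) set \<Rightarrow> real ^ 'n ^ 'n \<Rightarrow> (real \<Rightarrow> real \<Rightarrow> real) \<Rightarrow> real ^ 'n \<Rightarrow> real" where
  "laplacian_prod E w \<theta> p = pos_eigenvalue_prod (weighted_laplacian E w \<theta> p)"

(* The functions differentiated below (phi-divergence, theta_ij, product of positive eigenvalues)
   are given by formulas that make sense on the whole open positive orthant.  This is the
   extension of functions on the simplex used for the partial derivatives; the tangential
   difference does not depend on the choice of a smooth extension. *)
definition partial_deriv :: "'n \<Rightarrow> (real ^ 'n \<Rightarrow> real) \<Rightarrow> real ^ 'n::finite \<Rightarrow> real" where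
  "partial_deriv k f p = deriv (\<lambda>t. f (p + t *\<^sub>R axis k 1)) 0"

(* (d/dp_j - d/dp_i) f, evaluated at p *)
definition tangential_deriv :: "'n \<Rightarrow> 'n \<Rightarrow> (real ^ 'n \<Rightarrow> real) \<Rightarrow> real ^ 'n::finite \<Rightarrow> real" where
  "tangential_deriv i j f p = partial_deriv j f p - partial_deriv i f p"

definition Q_matrix :: "('n::finite \<times> 'n) set \<Rightarrow> real ^ 'n ^ 'n \<Rightarrow> real ^ 'n ^ 'n" where
  "Q_matrix E w = (\<chi> i j.
     if j = i then - (\<Sum>k\<in>neighbours E i. w $ i $ k / vertex_measure E w $ i)
     else w $ i $ j / vertex_measure E w $ i)"

definition A_coeff ::
  "('n::finite \<times> 'n) set \<Rightarrow> real ^ 'n ^ 'n \<Rightarrow> (real \<Rightarrow> real \<Rightarrow> real) \<Rightarrow> real ^ 'n \<Rightarrow> real \<Rightarrow> real ^ 'n ^ 'n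
     \<Rightarrow> 'n \<Rightarrow> 'n \<Rightarrow> real" where
  "A_coeff E w \<theta> p \<beta> Bdot i j =
     \<beta> * w $ i $ j * edge_theta E w \<theta> p i j *
       tangential_deriv i j (\<lambda>q. ln (sqrt (laplacian_prod E w \<theta> q) / edge_theta E w \<theta> q i j)) p +
     sqrt (\<beta> * w $ i $ j * edge_theta E w \<theta> p i j) * (Bdot $ i $ j - Bdot $ j $ i)"

definition a_coeff ::
  "('n::finite \<times> 'n) set \<Rightarrow> real ^ 'n ^ 'n \<Rightarrow> (real \<Rightarrow> real \<Rightarrow> real) \<Rightarrow> real ^ 'n \<Rightarrow> real \<Rightarrow> real ^ 'n ^ 'n
     \<Rightarrow> 'n \<Rightarrow> 'n \<Rightarrow> real" where
  "a_coeff E w \<theta> p \<beta> Bdot i j = 1 / p $ i * max 0 (A_coeff E w \<theta> p \<beta> Bdot j i)"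

definition QW_matrix ::
  "('n::finite \<times> 'n) set \<Rightarrow> real ^ 'n ^ 'n \<Rightarrow> (real \<Rightarrow> real \<Rightarrow> real) \<Rightarrow> real ^ 'n \<Rightarrow> real \<Rightarrow> real ^ 'n ^ 'n
     \<Rightarrow> real ^ 'n ^ 'n" where
  "QW_matrix E w \<theta> p \<beta> Bdot = (\<chi> i j.
     if j = i then - (\<Sum>k\<in>neighbours E i. Q_matrix E w $ i $ k + a_coeff E w \<theta> p \<beta> Bdot i k)
     else Q_matrix E w $ i $ j + a_coeff E w \<theta> p \<beta> Bdot i j)"

(* i-th component of the right-hand side of the stochastic differential equation after formal
   division by dt, with Bdot $ i $ j in place of dB_ij/dt *)
definition sde_rhs ::
  "('n::finite \<times> 'n) set \<Rightarrow> real ^ 'n ^ 'n \<Rightarrow> (real \<Rightarrow> real) \<Rightarrow> (real \<Rightarrow> real \<Rightarrow> real) \<Rightarrow> real ^ 'n \<Rightarrow> real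
     \<Rightarrow> real ^ 'n ^ 'n \<Rightarrow> 'n \<Rightarrow> real" where
  "sde_rhs E w \<phi> \<theta> p \<beta> Bdot i =
     (\<Sum>j\<in>neighbours E i. w $ i $ j * edge_theta E w \<theta> p i j *
        tangential_deriv i j (phi_divergence E w \<phi>) p) +
     \<beta> * (\<Sum>j\<in>neighbours E i. w $ i $ j * edge_theta E w \<theta> p i j *
        tangential_deriv i j (\<lambda>q. ln (sqrt (laplacian_prod E w \<theta> q) / edge_theta E w \<theta> q i j)) p) +
     sqrt \<beta> * (\<Sum>j\<in>neighbours E i. sqrt (w $ i $ j * edge_theta E w \<theta> p i j) *
        (Bdot $ i $ j - Bdot $ j $ i))"

end

theory Submission
  imports Defs
begin

text \<open>
  Both sides of the evolution equation are sums of antisymmetric edge fluxes, and the proof compares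
  them edge by edge.

  The drift by the divergence reproduces the original \<open>Q\<close>-matrix because \<open>\<theta>\<close> is tailored to \<open>\<phi>\<close>:
  the partial derivative of the divergence in \<open>p\<^sub>j\<close> is \<open>\<phi>'(p\<^sub>j / \<pi>\<^sub>j)\<close>, and multiplying the
  difference of two such derivatives by \<open>\<theta>\<^sub>i\<^sub>j\<close> cancels the denominator of the quotient that
  defines \<open>\<theta>\<close>, leaving the linear flux \<open>p\<^sub>j / \<pi>\<^sub>j - p\<^sub>i / \<pi>\<^sub>i\<close>
  (\<open>edge_theta_times_divergence_deriv\<close>).

  The remaining terms form the flux \<open>A\<^sub>i\<^sub>j\<close>, which may have either sign and so is not itself a
  transition rate. However, \<open>A\<close> is antisymmetric (\<open>A_coeff_antisym\<close>), so splitting it into positive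
  and negative parts gives \<open>A\<^sub>i\<^sub>j = max 0 A\<^sub>i\<^sub>j - max 0 A\<^sub>j\<^sub>i\<close>. The first part is the mass moved per unit
  time from \<open>j\<close> to \<open>i\<close> and the second the mass moved back; dividing each by the mass at its source
  yields the nonnegative rates \<open>a\<^sub>j\<^sub>i\<close> and \<open>a\<^sub>i\<^sub>j\<close>.

  The antisymmetry comes from the symmetry of \<open>\<theta>\<close> and \<open>\<omega>\<close> and from the sign change of a tangential
  derivative when its two indices are exchanged. The row sums vanish by the choice of the diagonal,
  and both terms of \<open>A\<^sub>i\<^sub>j\<close> carry a factor \<open>\<beta>\<close> or \<open>sqrt \<beta>\<close>, so that nothing but \<open>Q\<close> remains for
  \<open>\<beta> = 0\<close>.
\<close>

section \<open>Partial derivatives\<close>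

text \<open>Partial derivatives are local, so formulas that agree only on the open positive orthant may be
  exchanged inside them at a point of the simplex.\<close>

lemma partial_deriv_cong:
  assumes "\<forall>\<^sub>F q in nhds p. f q = g q"
  shows "partial_deriv k f p = partial_deriv k g p"
proof -
  have "((\<lambda>t. p + t *\<^sub>R axis k 1) \<longlongrightarrow> p + 0 *\<^sub>R axis k 1) (nhds (0::real))"
    by (intro tendsto_intros filterlim_ident)
  then have "filterlim (\<lambda>t. p + t *\<^sub>R axis k 1) (nhds p) (nhds (0::real))"
    by simp
  then have "\<forall>\<^sub>F t in nhds (0::real). f (p + t *\<^sub>R axis k 1) = g (p + t *\<^sub>R axis k 1)"
    using assms by (rule eventually_compose_filterlim[rotated])
  then show ?thesis
    unfolding partial_deriv_def by (rule deriv_cong_ev) simp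
qed

lemma tangential_deriv_cong:
  assumes "\<forall>\<^sub>F q in nhds p. f q = g q"
  shows "tangential_deriv i j f p = tangential_deriv i j g p"
  unfolding tangential_deriv_def using partial_deriv_cong[OF assms] by simp

lemma tangential_deriv_swap: "tangential_deriv j i f p = - tangential_deriv i j f p"
  by (simp add: tangential_deriv_def)

lemma eventually_component_pos:
  fixes p :: "real ^ 'n"
  assumes "p $ i > 0"
  shows "\<forall>\<^sub>F q in nhds p. q $ i > 0"
proof -
  have "((\<lambda>q. q $ i) \<longlongrightarrow> p $ i) (nhds p)"
    by (intro tendsto_intros filterlim_ident)
  then show ?thesis
    using assms by (rule order_tendstoD)
qed

section \<open>The invariant measure and the rates of the original chain\<close>

lemma (in weighted_graph) weight_nonneg: "w $ i $ j \<ge> 0"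
  using weight_pos[of i j] weight_zero[of i j] by (cases "(i, j) \<in> E") auto

lemma (in weighted_graph) total_weight_nonneg: "(\<Sum>(k, l)\<in>E. w $ k $ l) \<ge> 0"
  by (intro sum_nonneg) (auto simp: weight_nonneg)

lemma (in weighted_graph) vertex_measure_nonneg: "vertex_measure E w $ i \<ge> 0"
  using total_weight_nonneg
  by (auto simp: vertex_measure_def intro!: divide_nonneg_nonneg sum_nonneg weight_nonneg)

text \<open>On the graph with a single vertex the measure is \<open>0 / 0 = 0\<close>, so positivity needs an edge at the
  vertex; it is only divided by where there is one.\<close>

lemma (in weighted_graph) vertex_measure_pos:
  assumes "(i, j) \<in> E"
  shows "vertex_measure E w $ i > 0"
proof -
  have "(\<Sum>k\<in>neighbours E i. w $ i $ k) > 0"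
    using assms by (intro sum_pos) (auto simp: neighbours_def weight_pos)
  moreover have "(\<Sum>(k, l)\<in>E. w $ k $ l) > 0"
    using assms by (intro sum_pos) (auto simp: weight_pos)
  ultimately show ?thesis
    by (simp add: vertex_measure_def)
qed

lemma (in weighted_graph) edge_sym: "(i, j) \<in> E \<longleftrightarrow> (j, i) \<in> E"
  using sym_edges by (auto dest: symD)

lemma (in weighted_graph) edge_irrefl: "(i, i) \<notin> E"
  using no_self_loops by (auto simp: irrefl_def)

lemma (in weighted_graph) neighbours_subset: "neighbours E i \<subseteq> UNIV - {i}"
  using edge_irrefl by (auto simp: neighbours_def)

section \<open>The gradient of the divergence\<close>

lemma partial_deriv_phi_divergence:
  assumes pos: "vertex_measure E w $ j > 0" "p $ j > 0"
    and diff: "\<And>x. x > 0 \<Longrightarrow> \<phi> differentiable (at x)"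
  shows "partial_deriv j (phi_divergence E w \<phi>) p = deriv \<phi> (p $ j / vertex_measure E w $ j)"
proof -
  define \<pi> where "\<pi> = vertex_measure E w"
  define x where "x = p $ j / \<pi> $ j"
  have \<pi>: "\<pi> $ j > 0" and x: "x > 0"
    using pos by (auto simp: \<pi>_def x_def)
  have phi: "(\<phi> has_real_derivative deriv \<phi> x) (at x)"
    using diff[OF x] by (simp add: real_differentiable_def DERIV_deriv_iff_real_differentiable)
  have summand: "((\<lambda>t. \<phi> ((p + t *\<^sub>R axis j 1) $ k / \<pi> $ k) * \<pi> $ k) has_real_derivative
      (if k = j then deriv \<phi> x else 0)) (at 0)" for k
  proof (cases "k = j")
    case True
    have inner: "((\<lambda>t. (p $ j + t) / \<pi> $ j) has_real_derivative 1 / \<pi> $ j) (at 0)"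
      using \<pi> by (auto intro!: derivative_eq_intros)
    have "((\<lambda>t. \<phi> ((p $ j + t) / \<pi> $ j)) has_real_derivative deriv \<phi> x * (1 / \<pi> $ j)) (at 0)"
      using DERIV_chain2[OF _ inner, of \<phi> "deriv \<phi> x"] phi by (simp add: x_def)
    from DERIV_cmult_right[OF this, of "\<pi> $ j"] show ?thesis
      using True \<pi> by (simp add: axis_def)
  next
    case False
    then show ?thesis by (simp add: axis_def)
  qed
  have "((\<lambda>t. \<Sum>k\<in>UNIV. \<phi> ((p + t *\<^sub>R axis j 1) $ k / \<pi> $ k) * \<pi> $ k) has_real_derivative
      (\<Sum>k\<in>UNIV. if k = j then deriv \<phi> x else 0)) (at 0)"
    by (rule DERIV_sum) (rule summand)
  then show ?thesis
    unfolding partial_deriv_def phi_divergence_def \<pi>_def[symmetric] x_def[symmetric]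
    by (intro DERIV_imp_deriv) simp
qed

text \<open>Positivity of \<open>\<theta>\<close> is what makes the cancellation valid: if \<open>\<phi>'\<close> took the same value at two
  points, then the quotient, read with \<open>1 / 0 = 0\<close>, would make \<open>\<theta>\<close> vanish there.\<close>

lemma (in average_function) theta_times_deriv_diff:
  assumes "x > 0" "y > 0"
  shows "\<theta> x y * (deriv \<phi> y - deriv \<phi> x) = y - x"
proof (cases "x = y")
  case False
  have "deriv \<phi> x \<noteq> deriv \<phi> y"
    using theta_quotient[OF assms False] theta_pos[of x y] assms by auto
  then show ?thesis
    using theta_quotient[OF assms False] by (simp add: field_simps)
qed simp

lemma (in weighted_graph) edge_theta_times_divergence_deriv:
  assumes average: "average_function \<phi> \<theta>"
    and p: "p \<in> open_simplex" and edge: "(i, j) \<in> E"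
  shows "edge_theta E w \<theta> p i j * tangential_deriv i j (phi_divergence E w \<phi>) p
    = p $ j / vertex_measure E w $ j - p $ i / vertex_measure E w $ i"
proof -
  interpret average_function \<phi> \<theta> by (rule average)
  have pos: "p $ i > 0" "p $ j > 0" "vertex_measure E w $ i > 0" "vertex_measure E w $ j > 0"
    using p edge vertex_measure_pos edge_sym by (auto simp: open_simplex_def)
  then have "tangential_deriv i j (phi_divergence E w \<phi>) p
      = deriv \<phi> (p $ j / vertex_measure E w $ j) - deriv \<phi> (p $ i / vertex_measure E w $ i)"
    by (simp add: tangential_deriv_def partial_deriv_phi_divergence phi_differentiable)
  then show ?thesis
    using pos by (simp add: edge_theta_def theta_times_deriv_diff)
qed

section \<open>The antisymmetric flux\<close>

lemma (in weighted_graph) edge_theta_sym: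
  assumes average: "average_function \<phi> \<theta>" and "q $ i \<ge> 0" "q $ j \<ge> 0"
  shows "edge_theta E w \<theta> q i j = edge_theta E w \<theta> q j i"
  using assms unfolding edge_theta_def
  by (intro average_function.theta_sym[OF average] divide_nonneg_nonneg vertex_measure_nonneg)

text \<open>The logarithms differentiated in \<open>A\<^sub>i\<^sub>j\<close> and \<open>A\<^sub>j\<^sub>i\<close> are the same function near \<open>p\<close>, since
  \<open>\<theta>\<close> is symmetric. The antisymmetry of the drift part thus comes from the direction of
  differentiation alone, and that of the noise from the difference of the two increments.\<close>

lemma (in weighted_graph) A_coeff_antisym:
  assumes average: "average_function \<phi> \<theta>" and p: "p \<in> open_simplex"
  shows "A_coeff E w \<theta> p \<beta> Bdot j i = - A_coeff E w \<theta> p \<beta> Bdot i j"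
proof -
  let ?f = "\<lambda>i j q. ln (sqrt (laplacian_prod E w \<theta> q) / edge_theta E w \<theta> q i j)"
  have pos: "p $ i > 0" "p $ j > 0"
    using p by (auto simp: open_simplex_def)
  have "\<forall>\<^sub>F q in nhds p. ?f j i q = ?f i j q"
    using eventually_component_pos[OF pos(1)] eventually_component_pos[OF pos(2)]
    by eventually_elim (simp add: edge_theta_sym[OF average, of _ j i])
  then have "tangential_deriv j i (?f j i) p = - tangential_deriv i j (?f i j) p"
    by (subst tangential_deriv_swap) (simp add: tangential_deriv_cong)
  moreover have "edge_theta E w \<theta> p j i = edge_theta E w \<theta> p i j"
    using edge_theta_sym[OF average, of p j i] pos by simp
  ultimately show ?thesis
    using weight_sym[of i j] by (simp add: A_coeff_def algebra_simps)
qed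

text \<open>A real number is the difference of its positive part and that of its negative, so the two
  rates across a pair of vertices together transport exactly the flux \<open>A\<^sub>i\<^sub>j\<close>.\<close>

lemma (in weighted_graph) a_coeff_flux:
  assumes average: "average_function \<phi> \<theta>" and p: "p \<in> open_simplex"
  shows "a_coeff E w \<theta> p \<beta> Bdot j i * p $ j - a_coeff E w \<theta> p \<beta> Bdot i j * p $ i
    = A_coeff E w \<theta> p \<beta> Bdot i j"
proof -
  have "p $ i \<noteq> 0" "p $ j \<noteq> 0"
    using p by (auto simp: open_simplex_def less_imp_neq[symmetric])
  then have "a_coeff E w \<theta> p \<beta> Bdot j i * p $ j - a_coeff E w \<theta> p \<beta> Bdot i j * p $ i
      = max 0 (A_coeff E w \<theta> p \<beta> Bdot i j) - max 0 (A_coeff E w \<theta> p \<beta> Bdot j i)"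
    by (simp add: a_coeff_def)
  also have "\<dots> = A_coeff E w \<theta> p \<beta> Bdot i j"
    using A_coeff_antisym[OF average p, of \<beta> Bdot j i] by (simp add: max_def)
  finally show ?thesis .
qed

lemma a_coeff_nonneg:
  assumes "p \<in> open_simplex"
  shows "a_coeff E w \<theta> p \<beta> Bdot i j \<ge> 0"
  using assms by (auto simp: a_coeff_def open_simplex_def less_imp_le)

lemma a_coeff_zero_noise: "a_coeff E w \<theta> p 0 Bdot i j = 0"
  by (simp add: a_coeff_def A_coeff_def)

section \<open>The Wasserstein Q-matrix\<close>

lemma (in weighted_graph) QW_matrix_edge:
  assumes "(i, j) \<in> E"
  shows "QW_matrix E w \<theta> p \<beta> Bdot $ i $ j
    = w $ i $ j / vertex_measure E w $ i + a_coeff E w \<theta> p \<beta> Bdot i j"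
  using assms edge_irrefl by (auto simp: QW_matrix_def Q_matrix_def)

lemma (in weighted_graph) QW_matrix_nonadjacent:
  assumes "(i, j) \<notin> E" "j \<noteq> i"
  shows "QW_matrix E w \<theta> p \<beta> Bdot $ i $ j = 0"
proof -
  have "w $ i $ j = 0" "w $ j $ i = 0"
    using weight_zero[OF assms(1)] weight_sym[of i j] by auto
  then show ?thesis
    using assms(2) by (simp add: QW_matrix_def Q_matrix_def a_coeff_def A_coeff_def)
qed

lemma (in weighted_graph) QW_matrix_row_sum:
  "(\<Sum>j\<in>UNIV. QW_matrix E w \<theta> p \<beta> Bdot $ i $ j) = 0"
proof -
  let ?M = "QW_matrix E w \<theta> p \<beta> Bdot"
  have "(\<Sum>j\<in>UNIV - {i}. ?M $ i $ j) = (\<Sum>j\<in>neighbours E i. ?M $ i $ j)"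
    using neighbours_subset
    by (intro sum.mono_neutral_right) (auto simp: neighbours_def QW_matrix_nonadjacent)
  also have "\<dots> = - ?M $ i $ i"
    using neighbours_subset[of i] by (auto simp: QW_matrix_def intro!: sum.cong)
  finally show ?thesis
    by (simp add: sum.remove[of UNIV i])
qed

lemma (in weighted_graph) QW_matrix_off_diagonal_nonneg:
  assumes "p \<in> open_simplex" "j \<noteq> i"
  shows "QW_matrix E w \<theta> p \<beta> Bdot $ i $ j \<ge> 0"
proof (cases "(i, j) \<in> E")
  case True
  then show ?thesis
    using a_coeff_nonneg[OF assms(1)] weight_nonneg vertex_measure_nonneg
    by (simp add: QW_matrix_edge)
qed (simp add: QW_matrix_nonadjacent assms(2))

lemma (in weighted_graph) QW_matrix_zero_noise: "QW_matrix E w \<theta> p 0 Bdot = Q_matrix E w"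
proof -
  have "QW_matrix E w \<theta> p 0 Bdot $ i $ i = Q_matrix E w $ i $ i" for i
    using neighbours_subset[of i]
    by (auto simp: QW_matrix_def Q_matrix_def a_coeff_zero_noise intro!: sum.cong)
  moreover have "QW_matrix E w \<theta> p 0 Bdot $ i $ j = Q_matrix E w $ i $ j" if "j \<noteq> i" for i j
    using that by (simp add: QW_matrix_def a_coeff_zero_noise)
  ultimately show ?thesis
    by (metis vec_eq_iff)
qed

section \<open>The evolution equation\<close>

lemma sde_rhs_eq_flux_sum:
  "sde_rhs E w \<phi> \<theta> p \<beta> Bdot i =
    (\<Sum>j\<in>neighbours E i. w $ i $ j *
        (edge_theta E w \<theta> p i j * tangential_deriv i j (phi_divergence E w \<phi>) p)
      + A_coeff E w \<theta> p \<beta> Bdot i j)"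
  by (simp add: sde_rhs_def A_coeff_def sum.distrib sum_distrib_left real_sqrt_mult mult.assoc)

lemma (in weighted_graph) sde_rhs_eq_master_equation:
  assumes average: "average_function \<phi> \<theta>" and p: "p \<in> open_simplex"
  shows "sde_rhs E w \<phi> \<theta> p \<beta> Bdot i =
    (\<Sum>j\<in>UNIV. QW_matrix E w \<theta> p \<beta> Bdot $ j $ i * p $ j
              - QW_matrix E w \<theta> p \<beta> Bdot $ i $ j * p $ i)"
    (is "_ = (\<Sum>j\<in>UNIV. ?flux j)")
proof -
  have edge_flux: "w $ i $ j *
        (edge_theta E w \<theta> p i j * tangential_deriv i j (phi_divergence E w \<phi>) p)
      + A_coeff E w \<theta> p \<beta> Bdot i j = ?flux j" if "j \<in> neighbours E i" for j
  proof -
    have edge: "(i, j) \<in> E" "(j, i) \<in> E"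
      using that edge_sym by (auto simp: neighbours_def)
    show ?thesis
      unfolding edge_theta_times_divergence_deriv[OF average p edge(1)]
        a_coeff_flux[OF average p, symmetric]
        QW_matrix_edge[OF edge(1)] QW_matrix_edge[OF edge(2)]
      using weight_sym[of i j] by (simp add: algebra_simps)
  qed
  have no_flux: "?flux j = 0" if "j \<notin> neighbours E i" for j
    using that edge_sym[of i j] by (cases "j = i") (auto simp: neighbours_def QW_matrix_nonadjacent)
  have "sde_rhs E w \<phi> \<theta> p \<beta> Bdot i = (\<Sum>j\<in>neighbours E i. ?flux j)"
    unfolding sde_rhs_eq_flux_sum by (intro sum.cong refl edge_flux)
  also have "\<dots> = (\<Sum>j\<in>UNIV. ?flux j)"
    by (intro sum.mono_neutral_left ballI no_flux) auto
  finally show ?thesis .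
qed

theorem proposition4:
  fixes E :: "('n::finite \<times> 'n) set" and w :: "real ^ 'n ^ 'n"
    and \<phi> :: "real \<Rightarrow> real" and \<theta> :: "real \<Rightarrow> real \<Rightarrow> real"
  assumes graph: "weighted_graph E w"
    and average: "average_function \<phi> \<theta>"
  shows "(\<forall>\<beta>>0. \<forall>p\<in>open_simplex. \<forall>Bdot :: real ^ 'n ^ 'n.
            (\<forall>i. sde_rhs E w \<phi> \<theta> p \<beta> Bdot i =
               (\<Sum>j\<in>UNIV. QW_matrix E w \<theta> p \<beta> Bdot $ j $ i * p $ j
                         - QW_matrix E w \<theta> p \<beta> Bdot $ i $ j * p $ i)) \<and>
            (\<forall>i. (\<Sum>j\<in>UNIV. QW_matrix E w \<theta> p \<beta> Bdot $ i $ j) = 0) \<and>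
            (\<forall>i j. j \<noteq> i \<longrightarrow> QW_matrix E w \<theta> p \<beta> Bdot $ i $ j \<ge> 0)) \<and>
         (\<forall>p\<in>open_simplex. \<forall>Bdot :: real ^ 'n ^ 'n. QW_matrix E w \<theta> p 0 Bdot = Q_matrix E w)"
proof -
  interpret weighted_graph E w by (rule graph)
  show ?thesis
    by (auto simp: sde_rhs_eq_master_equation[OF average] QW_matrix_row_sum
        QW_matrix_off_diagonal_nonneg QW_matrix_zero_noise)
qed

end
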